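(* For $n, m \in \mathbb{N}$, let $kr^c_{2-2}(n,m)$ be the number of partitions $\lambda_1 \le \lambda_2 \le \cdots \le \lambda_m$ of $n$ into $m$ parts with difference at least three at distance three such that if parts at distance two differ by at most one, then their sum, together with the intermediate part, is $\equiv 2 \pmod{3}$. Then $$\sum_{m,n \geq 0} kr^c_{2-2}(n,m)\, q^n x^m = \sum_{\substack{n_1, n_3 \geq 0 \\ n_2 > 0}} \frac{ q^{ ( 9n_3^2 + n_3 )/2 + 2n_2^2 + n_2 + n_1^2 + 6n_3n_2 + 3n_3n_1 + 2n_2n_1 - 1 }\, (1 + q)(-q; q^2)_{n_2 - 1}\, x^{3n_3 + 2n_2 + n_1} }{ (q; q)_{n_1} (q^2; q^2)_{n_2} (q^3; q^3)_{n_3} } + \sum_{n_1, n_3 \geq 0} \frac{ q^{ ( 9n_3^2 + n_3 )/2 + n_1^2 + 3n_3n_1 }\, x^{3n_3 + n_1} }{ (q; q)_{n_1} (q^3; q^3)_{n_3} }$$ $$= \sum_{n_1, n_2, n_3 \geq 0} \frac{ q^{ ( 9n_3^2 + n_3 )/2 + 2n_2^2 + n_2 + n_1^2 + 6n_3n_2 + 3n_3n_1 + 2n_2n_1 }\, (-1/q; q^2)_{n_2}\, x^{3n_3 + 2n_2 + n_1} }{ (q; q)_{n_1} (q^2; q^2)_{n_2} (q^3; q^3)_{n_3} }.$$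
   Context: $\mathbb{N}=\{0,1,2,\dots\}$. A partition of $n$ into $m$ parts is a non-decreasing sequence $\lambda_1 \le \cdots \le \lambda_m$ of positive integers with sum $n$ (the empty partition is the unique partition of $0$, with $m=0$; it satisfies all the conditions vacuously). "Difference at least $k$ at distance $d$" means $\lambda_{j+d}-\lambda_j \ge k$ for all $1 \le j \le m-d$. The condition on parts at distance two says: for each $1\le j \le m-2$, if $\lambda_{j+2}-\lambda_j \le 1$ then $\lambda_j+\lambda_{j+1}+\lambda_{j+2}$ is in the stated residue class modulo $3$. The $q$-Pochhammer symbol is $(a;q)_n = \prod_{j=1}^{n}(1-aq^{j-1})$, with $(a;q)_0=1$. The identities are between formal power series in $q$ and $x$. The superscript $c$ and subscript $2-2$ in $kr^c_{2-2}$ are merely labels. *)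

theory Defs
  imports "HOL-Analysis.Infinite_Sum" "HOL-Computational_Algebra.Formal_Laurent_Series"
begin

text \<open>Lists are indexed from 0, so the part written \<open>\<lambda>\<^sub>j\<close> on paper is \<open>xs ! (j - 1)\<close>. Truncated
  subtraction of parts is harmless: the conditions are only applied to non-decreasing lists.\<close>

definition is_partition :: "nat \<Rightarrow> nat \<Rightarrow> nat list \<Rightarrow> bool" where
  "is_partition n m xs \<longleftrightarrow> sorted xs \<and> (\<forall>p\<in>set xs. 0 < p) \<and> sum_list xs = n \<and> length xs = m"

definition diff_at_least_at_dist :: "nat \<Rightarrow> nat \<Rightarrow> nat list \<Rightarrow> bool" where
  "diff_at_least_at_dist k d xs \<longleftrightarrow> (\<forall>j. j + d < length xs \<longrightarrow> xs ! (j + d) - xs ! j \<ge> k)"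

definition dist_two_cond :: "nat \<Rightarrow> nat list \<Rightarrow> bool" where
  "dist_two_cond r xs \<longleftrightarrow>
     (\<forall>j. j + 2 < length xs \<longrightarrow> xs ! (j + 2) - xs ! j \<le> 1 \<longrightarrow>
        (xs ! j + xs ! (j + 1) + xs ! (j + 2)) mod 3 = r mod 3)"

definition kr_c_2_2 :: "nat \<Rightarrow> nat \<Rightarrow> nat" where
  "kr_c_2_2 n m =
     card {xs. is_partition n m xs \<and> diff_at_least_at_dist 3 3 xs \<and> dist_two_cond 2 xs}"

lemma finite_partitions: "finite {xs. is_partition n m xs}"
proof (rule finite_subset)
  show "{xs. is_partition n m xs} \<subseteq> {xs. set xs \<subseteq> {..n} \<and> length xs = m}"
    by (auto simp: is_partition_def member_le_sum_list)
  show "finite {xs. set xs \<subseteq> {..n} \<and> length xs = m}"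
    by (rule finite_lists_length_eq) simp
qed

definition qpoch :: "'a::comm_ring_1 \<Rightarrow> 'a \<Rightarrow> nat \<Rightarrow> 'a" where
  "qpoch a q n = (\<Prod>j=1..n. 1 - a * q ^ (j - 1))"

text \<open>
  Since \<open>1/q\<close> occurs in one of the sums, everything lives in the ring \<^typ>\<open>rat fls fps\<close> of formal
  power series in \<open>x\<close> (outer) over the field of formal Laurent series in \<open>q\<close> (inner); it contains
  the ring of formal power series in \<open>q\<close> and \<open>x\<close>. Infinite sums are taken in the library's
  topology of \<^typ>\<open>rat fls fps\<close>, i.e. the \<open>x\<close>-adic one: a family is summable iff each coefficient
  of a power of \<open>x\<close> receives only finitely many nonzero contributions. The bivariate series with
  given coefficients is assembled coefficientwise, because for fixed \<open>m\<close> the terms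
  \<open>q\<^sup>n x\<^sup>m\<close> do not tend to zero \<open>x\<close>-adically.
\<close>

definition gen_fun :: "(nat \<Rightarrow> nat \<Rightarrow> nat) \<Rightarrow> rat fls fps" where
  "gen_fun a = Abs_fps (\<lambda>m. fps_to_fls (Abs_fps (\<lambda>n. of_nat (a n m))))"

end

theory Submission
  imports Defs
begin

text \<open>
  Reading a partition through its multiplicities \<open>f\<^sub>i\<close> (the number of parts equal to \<open>i\<close>), the two
  conditions become local: \<open>f\<^sub>i \<le> 2\<close>, \<open>f\<^sub>i = 2\<close> forces \<open>f\<^bsub>i+1\<^esub> = 0\<close>, and
  \<open>f\<^sub>i + f\<^bsub>i+1\<^esub> + f\<^bsub>i+2\<^esub> \<le> 3\<close>. Such a sequence is recognised by a finite automaton, and after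
  elimination three classes of partitions suffice, distinguished by how they may start: all of them
  (\<open>A\<close>), those without a repeated part \<open>1\<close> (\<open>E\<close>), and those which moreover do not begin with
  \<open>1, 2, 2\<close> (\<open>C\<close>). Removing an initial \<open>1, 1\<close> from a partition in \<open>A\<close>, an initial \<open>1, 2, 2\<close>
  from one in \<open>E\<close> or an initial \<open>1\<close> from one in \<open>C\<close> leaves a partition in \<open>E\<close>, \<open>E\<close> or \<open>C\<close>,
  shifted by \<open>2\<close>, \<open>3\<close> or \<open>1\<close>; and a partition without part \<open>1\<close> is one in \<open>A\<close>, shifted by \<open>1\<close>. A shift of all parts by \<open>k\<close>
  replaces \<open>x\<close> by \<open>x q\<^sup>k\<close> in the generating function, so

    \<open>A(x) = E(x) + q\<^sup>2 x\<^sup>2 E(x q\<^sup>2)\<close>,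
    \<open>E(x) = C(x) + q\<^sup>5 x\<^sup>3 E(x q\<^sup>3)\<close>,
    \<open>C(x) = A(x q) + q x C(x q)\<close>

  (lemmas \<open>gf_all\<close>, \<open>gf_no_pair\<close>, \<open>gf_no_triple\<close>). Comparing coefficients of powers of
  \<open>x\<close> shows that this system has only one solution with \<open>C(0) = 1\<close> (\<open>dilate_system_unique\<close>).

  On the other side, let \<open>F a b c\<close> be the triple series in which \<open>(-1/q; q\<^sup>2)\<close> is replaced by
  \<open>(-q; q\<^sup>2)\<close> and the summand is multiplied by \<open>q\<close> to the power \<open>a n\<^sub>1 + b n\<^sub>2 + c n\<^sub>3\<close>. Cancelling
  the last factor of one of the three denominators is an index shift, which gives a contiguity
  relation in each of the parameters \<open>a\<close>, \<open>b\<close>, \<open>c\<close>. It follows that the same system is solved by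
  \<open>E = F 0 0 0\<close>, \<open>C = F 0 0 3\<close> and \<open>A\<close> the series with \<open>(-1/q; q\<^sup>2)\<close>; the passage
  from \<open>E\<close> to \<open>A\<close> is the identity \<open>(1 + 1/q) (-q; q\<^sup>2)\<^sub>n - (-q; q\<^sup>2)\<^bsub>n+1\<^esub> =
  (1 - q\<^bsup>2n+2\<^esup>) (-q; q\<^sup>2)\<^sub>n / q\<close>. This yields the single triple sum; the form with two sums splits off
  the terms with \<open>n\<^sub>2 = 0\<close> and extracts the first factor \<open>1 + 1/q\<close> of \<open>(-1/q; q\<^sup>2)\<close> from the others.
\<close>

section \<open>Decomposition of the partitions by their first parts\<close>

definition admissible :: "nat list \<Rightarrow> bool" where
  "admissible xs \<longleftrightarrow> sorted xs \<and> diff_at_least_at_dist 3 3 xs \<and> dist_two_cond 2 xs"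

lemma all_shift_Cons:
  "(\<forall>j. j + d < length (x # xs) \<longrightarrow> P j) \<longleftrightarrow>
     (d \<le> length xs \<longrightarrow> P 0) \<and> (\<forall>j. j + d < length xs \<longrightarrow> P (Suc j))"
proof -
  have "(\<forall>j. Q j) \<longleftrightarrow> Q 0 \<and> (\<forall>j. Q (Suc j))" for Q :: "nat \<Rightarrow> bool"
    by (metis nat.exhaust)
  from this[of "\<lambda>j. j + d < length (x # xs) \<longrightarrow> P j"] show ?thesis
    by (simp add: less_Suc_eq_le Suc_le_eq)
qed

lemma admissible_Cons:
  "admissible (x # xs) \<longleftrightarrow> admissible xs \<and> (\<forall>y\<in>set xs. x \<le> y) \<and>
     (3 \<le> length xs \<longrightarrow> 3 \<le> xs ! 2 - x) \<and>
     (2 \<le> length xs \<longrightarrow> xs ! 1 - x \<le> 1 \<longrightarrow> (x + xs ! 0 + xs ! 1) mod 3 = 2)"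
  unfolding admissible_def diff_at_least_at_dist_def dist_two_cond_def all_shift_Cons
  by (simp add: conj_ac add.commute[of 3])

lemma admissible_Nil [simp]: "admissible []"
  by (simp add: admissible_def diff_at_least_at_dist_def dist_two_cond_def)

lemma admissible_single [simp]: "admissible [x]"
  by (simp add: admissible_Cons)

lemma admissible_pair [simp]: "admissible [x, y] \<longleftrightarrow> x \<le> y"
  by (simp add: admissible_Cons)

text \<open>The shapes \<open>i, i, i\<close> and \<open>i, i, i + 1\<close> and \<open>i, i + 1, i + 1\<close> have sums congruent to
  \<open>0\<close>, \<open>1\<close> and \<open>2\<close> modulo \<open>3\<close>, so the residue condition leaves only the last one.\<close>

lemma triple_residue:
  assumes "x \<le> y" "y \<le> z"
  shows "(z - x \<le> 1 \<longrightarrow> (x + y + z) mod 3 = (2::nat)) \<longleftrightarrow> x + 2 \<le> z \<or> (y = x + 1 \<and> z = x + 1)"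
proof -
  have "x + 2 \<le> z \<or> (y = x \<and> z = x) \<or> (y = x \<and> z = Suc x) \<or> (y = Suc x \<and> z = Suc x)"
    using assms by linarith
  moreover have "(x + x + x) mod 3 = 0" "(x + x + Suc x) mod 3 = 1"
      "(x + Suc x + Suc x) mod 3 = 2"
    by presburger+
  ultimately show ?thesis by auto
qed

lemma admissible_Cons3:
  "admissible (x # y # z # xs) \<longleftrightarrow> admissible (y # z # xs) \<and> x \<le> y \<and>
     (x + 2 \<le> z \<or> (y = x + 1 \<and> z = x + 1)) \<and> (xs \<noteq> [] \<longrightarrow> x + 3 \<le> hd xs)"
proof -
  have *: "admissible (x # y # z # xs) \<longleftrightarrow> admissible (y # z # xs) \<and> (\<forall>w\<in>set (y # z # xs). x \<le> w) \<and>
      (xs \<noteq> [] \<longrightarrow> 3 \<le> hd xs - x) \<and> (z - x \<le> 1 \<longrightarrow> (x + y + z) mod 3 = 2)"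
    by (subst admissible_Cons) (cases xs; simp)
  show ?thesis
  proof (cases "admissible (y # z # xs) \<and> x \<le> y")
    case True
    then have "y \<le> z" "\<forall>w\<in>set xs. y \<le> w"
      by (simp_all add: admissible_Cons)
    with True have "\<forall>w\<in>set (y # z # xs). x \<le> w"
      by auto
    moreover have "3 \<le> hd xs - x \<longleftrightarrow> x + 3 \<le> hd xs"
      by arith
    ultimately show ?thesis
      unfolding * using True triple_residue[of x y z] \<open>y \<le> z\<close> by blast
  next
    case False
    then show ?thesis unfolding * by auto
  qed
qed

lemma admissible_mono: "admissible (x # y # xs) \<Longrightarrow> x \<le> y \<and> (xs \<noteq> [] \<longrightarrow> y \<le> hd xs)"
  by (cases xs) (auto simp: admissible_Cons)

lemma admissible_shift: "admissible (map ((+) k) xs) \<longleftrightarrow> admissible xs"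
proof (induction xs)
  case (Cons x xs)
  then show ?case
    by (cases xs rule: remdups_adj.cases) (auto simp: admissible_Cons3 hd_map)
qed simp

text \<open>For \<open>k = 0\<close> these are the classes \<open>A\<close>, \<open>E\<close> and \<open>C\<close>. The offset \<open>k\<close> serves to describe
  what remains after the first parts are removed.\<close>

definition all_above :: "nat \<Rightarrow> nat list set" where
  "all_above k = {xs. admissible xs \<and> (\<forall>p\<in>set xs. k < p)}"

definition no_pair :: "nat \<Rightarrow> nat list set" where
  "no_pair k = {xs \<in> all_above k. \<forall>ys. xs \<noteq> Suc k # Suc k # ys}"

definition no_triple :: "nat \<Rightarrow> nat list set" where
  "no_triple k = {xs \<in> no_pair k. \<forall>ys. xs \<noteq> Suc k # Suc (Suc k) # Suc (Suc k) # ys}"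

lemma shift_preimage:
  fixes k :: nat
  assumes "\<forall>p\<in>set xs. k \<le> p"
  obtains ys where "xs = map ((+) k) ys"
proof
  show "xs = map ((+) k) (map (\<lambda>p. p - k) xs)"
    using assms by (simp add: map_idI)
qed

lemma shift_image_eqI:
  fixes k :: nat
  assumes "\<And>xs. xs \<in> T \<Longrightarrow> \<forall>p\<in>set xs. k \<le> p"
    and "\<And>xs. map ((+) k) xs \<in> T \<longleftrightarrow> xs \<in> S"
  shows "map ((+) k) ` S = T"
proof
  show "T \<subseteq> map ((+) k) ` S"
  proof
    fix xs assume "xs \<in> T"
    with assms(1) obtain ys where "xs = map ((+) k) ys" by (blast elim: shift_preimage)
    with assms(2) \<open>xs \<in> T\<close> show "xs \<in> map ((+) k) ` S" by blast
  qed
qed (use assms(2) in blast)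

lemma shift_all_above: "map ((+) k) ` all_above j = all_above (k + j)"
  by (rule shift_image_eqI) (force simp: all_above_def admissible_shift)+

lemma shift_no_pair: "map ((+) k) ` no_pair j = no_pair (k + j)"
  by (rule shift_image_eqI) (force simp: no_pair_def all_above_def admissible_shift map_eq_Cons_conv)+

lemma shift_no_triple: "map ((+) k) ` no_triple j = no_triple (k + j)"
  by (rule shift_image_eqI)
    (force simp: no_triple_def no_pair_def all_above_def admissible_shift map_eq_Cons_conv)+

lemma all_above_Cons_iff: "x # xs \<in> all_above k \<longleftrightarrow> admissible (x # xs) \<and> k < x"
  by (auto simp: all_above_def admissible_Cons intro: less_le_trans)

lemma Nil_in_classes [simp]: "[] \<in> all_above k" "[] \<in> no_pair k" "[] \<in> no_triple k"
  by (auto simp: all_above_def no_pair_def no_triple_def)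

text \<open>After a repeated part \<open>i\<close>, the part \<open>i + 1\<close> is excluded by the residue condition, and two
  parts equal to \<open>i + 2\<close> would contradict the difference condition at distance three.\<close>

lemma prepend_pair: "Suc k # Suc k # xs \<in> all_above k \<longleftrightarrow> xs \<in> no_pair (Suc (Suc k))"
proof (cases xs)
  case (Cons z zs)
  show ?thesis
    by (cases zs) (auto simp: Cons no_pair_def all_above_Cons_iff admissible_Cons3 dest: admissible_mono)
qed (simp add: all_above_Cons_iff)

text \<open>The parts from the second one on, \<open>k + 2, k + 2, \<dots>\<close>, are governed by the previous lemma. The
  initial part \<open>k + 1\<close> adds only that the fourth part is at least \<open>k + 4\<close>, which the previous lemma
  already gives.\<close>

lemma prepend_triple:
  "Suc k # Suc (Suc k) # Suc (Suc k) # xs \<in> all_above k \<longleftrightarrow> xs \<in> no_pair (Suc (Suc (Suc k)))"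
proof -
  have "Suc k # Suc (Suc k) # Suc (Suc k) # xs \<in> all_above k \<longleftrightarrow>
      Suc (Suc k) # Suc (Suc k) # xs \<in> all_above (Suc k) \<and> (xs \<noteq> [] \<longrightarrow> k + 4 \<le> hd xs)"
    by (auto simp: all_above_Cons_iff admissible_Cons3)
  also have "\<dots> \<longleftrightarrow> xs \<in> no_pair (Suc (Suc (Suc k)))"
    unfolding prepend_pair
    by (cases xs) (auto simp: no_pair_def all_above_Cons_iff)
  finally show ?thesis .
qed

text \<open>In front of a partition with parts above \<open>k + 1\<close>, a single part \<open>k + 1\<close> produces a forbidden
  start exactly when what follows begins with \<open>k + 2, k + 2\<close> (excluded from the class on the left) or
  with \<open>k + 2, k + 3, k + 3\<close> (the difference condition). So the class reproduces itself.\<close>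

lemma prepend_single: "Suc k # xs \<in> no_triple k \<longleftrightarrow> xs \<in> no_triple (Suc k)"
proof -
  consider "xs = []" | y where "xs = [y]" | y z where "xs = [y, z]"
    | y z w ws where "xs = y # z # w # ws"
    by (cases xs rule: remdups_adj.cases; cases "tl (tl xs)") auto
  then show ?thesis
    by cases (auto simp: no_triple_def no_pair_def all_above_Cons_iff admissible_Cons3 dest: admissible_mono)
qed

lemma all_above_decomp: "all_above k = no_pair k \<union> (@) [Suc k, Suc k] ` no_pair (Suc (Suc k))"
  by (auto simp: no_pair_def[of k] prepend_pair[symmetric])

lemma no_pair_decomp:
  "no_pair k = no_triple k \<union> (@) [Suc k, Suc (Suc k), Suc (Suc k)] ` no_pair (Suc (Suc (Suc k)))"
  by (auto simp: no_triple_def prepend_triple[symmetric] no_pair_def[of k])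

lemma no_triple_decomp: "no_triple k = all_above (Suc k) \<union> (@) [Suc k] ` no_triple (Suc k)"
proof -
  have "xs \<in> all_above (Suc k) \<longleftrightarrow> xs \<in> no_triple k \<and> (\<forall>ys. xs \<noteq> Suc k # ys)" for xs
    by (cases xs) (auto simp: no_triple_def no_pair_def all_above_Cons_iff)
  then show ?thesis
    by (auto simp: prepend_single[symmetric])
qed

section \<open>Dilation and the functional equations\<close>

text \<open>The substitution of \<open>c x\<close> for \<open>x\<close>.\<close>

definition dilate :: "'a::comm_ring_1 \<Rightarrow> 'a fps \<Rightarrow> 'a fps" where
  "dilate c f = Abs_fps (\<lambda>m. c ^ m * f $ m)"

lemma dilate_nth [simp]: "dilate c f $ m = c ^ m * f $ m"
  by (simp add: dilate_def)

lemma dilate_add: "dilate c (f + g) = dilate c f + dilate c g"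
  by (simp add: fps_eq_iff algebra_simps)

lemma monomial_mult_nth:
  "(fps_const c * fps_X ^ l * f) $ m = (if m < l then 0 else c * f $ (m - l))"
  by (simp add: mult.assoc fps_X_power_mult_nth)

lemma dilate_monomial_mult:
  "dilate c (fps_const a * fps_X ^ l * f) = fps_const (a * c ^ l) * fps_X ^ l * dilate c f"
proof (rule fps_ext)
  fix m
  have "c ^ m = c ^ l * c ^ (m - l)" if "l \<le> m"
    using that by (simp flip: power_add)
  then show "dilate c (fps_const a * fps_X ^ l * f) $ m =
      (fps_const (a * c ^ l) * fps_X ^ l * dilate c f) $ m"
    unfolding dilate_nth monomial_mult_nth by (simp add: mult_ac)
qed

text \<open>By the first two equations, the coefficient of \<open>x\<^sup>m\<close> in \<open>A\<close> is that of \<open>C\<close> plus terms of lower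
  index. The third equation then reads \<open>(1 - q\<^sup>m) C\<^sub>m = \<dots>\<close> with lower terms on the right,
  and determines \<open>C\<^sub>m\<close> for \<open>m > 0\<close>.\<close>

lemma dilate_system_unique:
  fixes q :: "'a::field"
  assumes q: "\<And>m. 0 < m \<Longrightarrow> q ^ m \<noteq> 1"
    and A: "A = E + fps_const (q ^ 2) * fps_X ^ 2 * dilate (q ^ 2) E"
    and E: "E = C + fps_const (q ^ 5) * fps_X ^ 3 * dilate (q ^ 3) E"
    and C: "C = dilate q A + fps_const q * fps_X * dilate q C"
    and A': "A' = E' + fps_const (q ^ 2) * fps_X ^ 2 * dilate (q ^ 2) E'"
    and E': "E' = C' + fps_const (q ^ 5) * fps_X ^ 3 * dilate (q ^ 3) E'"
    and C': "C' = dilate q A' + fps_const q * fps_X * dilate q C'"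
    and init: "C $ 0 = C' $ 0"
  shows "A = A'"
proof -
  have A_nth: "a $ m = e $ m + (if m < 2 then 0 else q ^ 2 * ((q ^ 2) ^ (m - 2) * e $ (m - 2)))"
    if "a = e + fps_const (q ^ 2) * fps_X ^ 2 * dilate (q ^ 2) e" for a e m
    by (subst that) (simp add: monomial_mult_nth)
  have E_nth: "e $ m = c $ m + (if m < 3 then 0 else q ^ 5 * ((q ^ 3) ^ (m - 3) * e $ (m - 3)))"
    if "e = c + fps_const (q ^ 5) * fps_X ^ 3 * dilate (q ^ 3) e" for c e m
    by (subst that) (simp add: monomial_mult_nth)
  have C_nth: "c $ m = q ^ m * a $ m + (if m < 1 then 0 else q * (q ^ (m - 1) * c $ (m - 1)))"
    if "c = dilate q a + fps_const q * fps_X * dilate q c" for a c m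
    using monomial_mult_nth[of q 1] by (subst that) simp
  have "A $ m = A' $ m \<and> E $ m = E' $ m \<and> C $ m = C' $ m" for m
  proof (induction m rule: less_induct)
    case (less m)
    \<comment> \<open>\<open>u\<close> and, below, \<open>v\<close> collect the terms of index less than \<open>m\<close>, which agree on both sides.\<close>
    obtain u where u: "A $ m = C $ m + u" "A' $ m = C' $ m + u"
      using A_nth[OF A, of m] A_nth[OF A', of m] E_nth[OF E, of m] E_nth[OF E', of m]
        less.IH[of "m - 2"] less.IH[of "m - 3"]
      by (cases "m < 2"; cases "m < 3") (simp_all add: add.assoc)
    have "C $ m = C' $ m"
    proof (cases "m = 0")
      case False
      then obtain v where "C $ m = q ^ m * A $ m + v" "C' $ m = q ^ m * A' $ m + v"
        using C_nth[OF C, of m] C_nth[OF C', of m] less.IH[of "m - 1"] by simp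
      then have "C $ m - q ^ m * (C $ m + u) = v" "C' $ m - q ^ m * (C' $ m + u) = v"
        unfolding u by (metis add_diff_cancel_left')+
      then have "C $ m - q ^ m * (C $ m + u) = C' $ m - q ^ m * (C' $ m + u)"
        by (rule trans[OF _ sym])
      then have "(1 - q ^ m) * C $ m = (1 - q ^ m) * C' $ m"
        by (simp add: algebra_simps)
      then show ?thesis using q[of m] False by simp
    qed (simp add: init)
    moreover from this have "E $ m = E' $ m"
      using E_nth[OF E, of m] E_nth[OF E', of m] less.IH[of "m - 3"] by simp
    ultimately show ?case using u by simp
  qed
  then show ?thesis by (simp add: fps_eq_iff)
qed

section \<open>Generating functions of the partition classes\<close>

definition list_gf :: "nat list set \<Rightarrow> rat fls fps" where
  "list_gf S = gen_fun (\<lambda>n m. card {xs \<in> S. sum_list xs = n \<and> length xs = m})"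

lemma list_gf_nth:
  "list_gf S $ m = fps_to_fls (Abs_fps (\<lambda>n. of_nat (card {xs \<in> S. sum_list xs = n \<and> length xs = m})))"
  by (simp add: list_gf_def gen_fun_def)

text \<open>Prepending fixed parts (\<open>d = 0\<close>) and shifting all parts by \<open>d\<close> (\<open>s = l = 0\<close>) are the two
  cases in use; both are affine in the length of the list.\<close>

lemma list_gf_image:
  assumes inj: "inj_on f S"
    and sum: "\<And>xs. xs \<in> S \<Longrightarrow> sum_list (f xs) = sum_list xs + (d * length xs + s)"
    and len: "\<And>xs. xs \<in> S \<Longrightarrow> length (f xs) = length xs + l"
  shows "list_gf (f ` S) = fps_const (fls_X ^ s) * fps_X ^ l * dilate (fls_X ^ d) (list_gf S)"
proof (rule fps_ext)
  fix m
  have rhs: "(fps_const (fls_X ^ s) * fps_X ^ l * dilate (fls_X ^ d) (list_gf S)) $ m =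
      (if m < l then 0 else fls_X ^ (d * (m - l) + s) * list_gf S $ (m - l))"
    unfolding monomial_mult_nth by (simp add: power_add power_mult mult_ac)
  show "list_gf (f ` S) $ m =
      (fps_const (fls_X ^ s) * fps_X ^ l * dilate (fls_X ^ d) (list_gf S)) $ m"
  proof (cases "m < l")
    case True
    then have empty: "{xs \<in> f ` S. sum_list xs = n \<and> length xs = m} = {}" for n
      using len by auto
    have "list_gf (f ` S) $ m = 0"
      unfolding list_gf_nth empty by (simp flip: fps_zero_def)
    with True show ?thesis by (simp add: rhs)
  next
    case False
    define k where "k = d * (m - l) + s"
    define N where "N n = card {xs \<in> S. sum_list xs = n \<and> length xs = m - l}" for n
    have "card {xs \<in> f ` S. sum_list xs = n \<and> length xs = m} = (if n < k then 0 else N (n - k))" for n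
    proof -
      have eq: "{xs \<in> f ` S. sum_list xs = n \<and> length xs = m} =
          f ` {xs \<in> S. sum_list xs + k = n \<and> length xs = m - l}"
        using False by (auto simp: sum len k_def)
      have "card {xs \<in> f ` S. sum_list xs = n \<and> length xs = m} =
          card {xs \<in> S. sum_list xs + k = n \<and> length xs = m - l}"
        unfolding eq by (rule card_image) (use inj in \<open>auto intro: inj_on_subset\<close>)
      also have "{xs \<in> S. sum_list xs + k = n \<and> length xs = m - l} =
          (if n < k then {} else {xs \<in> S. sum_list xs = n - k \<and> length xs = m - l})"
        by auto
      finally show ?thesis by (simp add: N_def)
    qed
    then have "list_gf (f ` S) $ m = fps_to_fls (fps_X ^ k * Abs_fps (\<lambda>n. of_nat (N n)))"
      by (subst list_gf_nth, intro arg_cong[where f = fps_to_fls] fps_ext)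
        (simp add: fps_X_power_mult_nth)
    also have "\<dots> = fls_X ^ k * list_gf S $ (m - l)"
      by (simp add: list_gf_nth N_def fls_times_fps_to_fls fps_to_fls_power)
    finally show ?thesis using False by (simp add: rhs k_def)
  qed
qed

lemma list_gf_prepend:
  "list_gf ((@) ps ` S) = fps_const (fls_X ^ sum_list ps) * fps_X ^ length ps * list_gf S"
proof -
  have "dilate (fls_X ^ 0) (list_gf S) = list_gf S"
    by (simp add: fps_eq_iff)
  then show ?thesis
    using list_gf_image[of "(@) ps" S 0 "sum_list ps" "length ps"] by (simp add: inj_on_def)
qed

lemma list_gf_shift: "list_gf (map ((+) k) ` S) = dilate (fls_X ^ k) (list_gf S)"
proof -
  have "sum_list (map ((+) k) xs) = sum_list xs + k * length xs" for xs
    by (induction xs) auto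
  moreover have "inj_on (map ((+) k)) S"
    by (rule inj_on_subset[OF inj_mapI]) auto
  ultimately show ?thesis
    using list_gf_image[of "map ((+) k)" S k 0 0] by simp
qed

lemma list_gf_Un:
  assumes "S \<union> T \<subseteq> all_above 0" "S \<inter> T = {}"
  shows "list_gf (S \<union> T) = list_gf S + list_gf T"
proof (rule fps_ext)
  fix m
  have "card {xs \<in> S \<union> T. sum_list xs = n \<and> length xs = m} =
      card {xs \<in> S. sum_list xs = n \<and> length xs = m} + card {xs \<in> T. sum_list xs = n \<and> length xs = m}" for n
  proof -
    have "finite {xs \<in> S \<union> T. sum_list xs = n \<and> length xs = m}"
      by (rule finite_subset[OF _ finite_partitions[of n m]])
        (use assms(1) in \<open>auto simp: all_above_def admissible_def is_partition_def\<close>)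
    moreover have "{xs \<in> S \<union> T. sum_list xs = n \<and> length xs = m} =
        {xs \<in> S. sum_list xs = n \<and> length xs = m} \<union> {xs \<in> T. sum_list xs = n \<and> length xs = m}"
      by auto
    ultimately show ?thesis
      using assms(2) by (subst card_Un_disjoint[symmetric]) auto
  qed
  then have "Abs_fps (\<lambda>n. of_nat (card {xs \<in> S \<union> T. sum_list xs = n \<and> length xs = m})) =
      Abs_fps (\<lambda>n. of_nat (card {xs \<in> S. sum_list xs = n \<and> length xs = m})) +
      (Abs_fps (\<lambda>n. of_nat (card {xs \<in> T. sum_list xs = n \<and> length xs = m})) :: rat fps)"
    by (intro fps_ext) simp
  then show "list_gf (S \<union> T) $ m = (list_gf S + list_gf T) $ m"
    by (simp add: list_gf_nth)
qed

lemma gf_all: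
  "list_gf (all_above 0) = list_gf (no_pair 0) +
     fps_const (fls_X ^ 2) * fps_X ^ 2 * dilate (fls_X ^ 2) (list_gf (no_pair 0))"
proof -
  let ?T = "(@) [Suc 0, Suc 0] ` no_pair (Suc (Suc 0))"
  have "list_gf (no_pair (Suc (Suc 0))) = dilate (fls_X ^ 2) (list_gf (no_pair 0))"
    using shift_no_pair[of 2 0] list_gf_shift[of 2 "no_pair 0"] by (simp add: numeral_2_eq_2)
  then have T: "list_gf ?T =
      fps_const (fls_X ^ 2) * fps_X ^ 2 * dilate (fls_X ^ 2) (list_gf (no_pair 0))"
    unfolding list_gf_prepend by (simp add: eval_nat_numeral)
  have "list_gf (no_pair 0 \<union> ?T) = list_gf (no_pair 0) + list_gf ?T"
  proof (rule list_gf_Un)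
    show "no_pair 0 \<union> ?T \<subseteq> all_above 0" unfolding all_above_decomp[of 0] ..
  qed (auto simp: no_pair_def)
  then show ?thesis
    unfolding T all_above_decomp[of 0, symmetric] .
qed

lemma gf_no_pair:
  "list_gf (no_pair 0) = list_gf (no_triple 0) +
     fps_const (fls_X ^ 5) * fps_X ^ 3 * dilate (fls_X ^ 3) (list_gf (no_pair 0))"
proof -
  let ?T = "(@) [Suc 0, Suc (Suc 0), Suc (Suc 0)] ` no_pair (Suc (Suc (Suc 0)))"
  have "list_gf (no_pair (Suc (Suc (Suc 0)))) = dilate (fls_X ^ 3) (list_gf (no_pair 0))"
    using shift_no_pair[of 3 0] list_gf_shift[of 3 "no_pair 0"] by (simp add: numeral_3_eq_3)
  then have T: "list_gf ?T =
      fps_const (fls_X ^ 5) * fps_X ^ 3 * dilate (fls_X ^ 3) (list_gf (no_pair 0))"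
    unfolding list_gf_prepend by (simp add: eval_nat_numeral)
  have "list_gf (no_triple 0 \<union> ?T) = list_gf (no_triple 0) + list_gf ?T"
  proof (rule list_gf_Un)
    have "no_triple 0 \<union> ?T = no_pair 0" by (rule no_pair_decomp[symmetric])
    then show "no_triple 0 \<union> ?T \<subseteq> all_above 0" unfolding no_pair_def by blast
  qed (auto simp: no_triple_def)
  then show ?thesis
    unfolding T no_pair_decomp[of 0, symmetric] .
qed

lemma gf_no_triple:
  "list_gf (no_triple 0) = dilate fls_X (list_gf (all_above 0)) +
     fps_const fls_X * fps_X * dilate fls_X (list_gf (no_triple 0))"
proof -
  let ?T = "(@) [Suc 0] ` no_triple (Suc 0)"
  have "list_gf (all_above (Suc 0)) = dilate fls_X (list_gf (all_above 0))"
    "list_gf (no_triple (Suc 0)) = dilate fls_X (list_gf (no_triple 0))"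
    using shift_all_above[of 1 0] shift_no_triple[of 1 0]
      list_gf_shift[of 1 "all_above 0"] list_gf_shift[of 1 "no_triple 0"] by simp_all
  moreover from this have "list_gf ?T = fps_const fls_X * fps_X * dilate fls_X (list_gf (no_triple 0))"
    unfolding list_gf_prepend by simp
  moreover have "list_gf (all_above (Suc 0) \<union> ?T) = list_gf (all_above (Suc 0)) + list_gf ?T"
  proof (rule list_gf_Un)
    have "all_above (Suc 0) \<union> ?T = no_triple 0" by (rule no_triple_decomp[symmetric])
    then show "all_above (Suc 0) \<union> ?T \<subseteq> all_above 0" unfolding no_pair_def no_triple_def by blast
  qed (auto simp: all_above_def)
  ultimately show ?thesis
    unfolding no_triple_decomp[of 0, symmetric] by argo
qed

lemma gf_no_triple_0: "list_gf (no_triple 0) $ 0 = 1"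
proof -
  have "{xs \<in> no_triple 0. sum_list xs = n \<and> length xs = 0} = (if n = 0 then {[]} else {})" for n
    by auto
  then have "Abs_fps (\<lambda>n. of_nat (card {xs \<in> no_triple 0. sum_list xs = n \<and> length xs = 0})) = (1 :: rat fps)"
    by (intro fps_ext) simp
  then show ?thesis by (simp add: list_gf_nth)
qed

lemma gf_kr: "gen_fun kr_c_2_2 = list_gf (all_above 0)"
proof -
  have "kr_c_2_2 n m = card {xs \<in> all_above 0. sum_list xs = n \<and> length xs = m}" for n m
    unfolding kr_c_2_2_def
    by (rule arg_cong[where f = card]) (auto simp: all_above_def admissible_def is_partition_def)
  then show ?thesis by (simp add: list_gf_def gen_fun_def)
qed

section \<open>Series graded by a weight\<close>

text \<open>The sum of \<open>f i x\<^bsup>w i\<^esup>\<close> over \<open>i \<in> A\<close>, collected by powers of \<open>x\<close>. Working with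
  coefficients makes index shifts and splittings statements about finite sums.\<close>

definition weighted_series :: "('i \<Rightarrow> nat) \<Rightarrow> 'i set \<Rightarrow> ('i \<Rightarrow> 'a::comm_ring_1) \<Rightarrow> 'a fps" where
  "weighted_series w A f = Abs_fps (\<lambda>m. \<Sum>i | i \<in> A \<and> w i = m. f i)"

text \<open>All but the finitely many indices of weight at most \<open>N\<close> leave the first \<open>N + 1\<close> coefficients
  unchanged, and convergence in the \<open>x\<close>-adic metric means that these become stationary.\<close>

lemma has_sum_weighted_series:
  fixes f :: "'i \<Rightarrow> 'a::comm_ring_1"
  assumes fin: "\<And>m. finite {i \<in> A. w i = m}"
  shows "((\<lambda>i. fps_const (f i) * fps_X ^ w i) has_sum weighted_series w A f) A"
  unfolding has_sum_def tendsto_iff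
proof (intro allI impI)
  fix e :: real assume "0 < e"
  then obtain N where N: "inverse (2 ^ N) < e"
    using real_arch_pow_inv[of e "1/2"] by (auto simp: power_one_over inverse_eq_divide)
  define B where "B = {i \<in> A. w i \<le> N}"
  have "B = (\<Union>m\<le>N. {i \<in> A. w i = m})" by (auto simp: B_def)
  then have "finite B" using fin by simp
  show "\<forall>\<^sub>F F in finite_subsets_at_top A.
      dist (\<Sum>i\<in>F. fps_const (f i) * fps_X ^ w i) (weighted_series w A f) < e"
    unfolding eventually_finite_subsets_at_top
  proof (intro exI[of _ B] conjI allI impI)
    fix F assume F: "finite F \<and> B \<subseteq> F \<and> F \<subseteq> A"
    have "(\<Sum>i\<in>F. fps_const (f i) * fps_X ^ w i) $ m = weighted_series w A f $ m" if "m \<le> N" for m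
    proof -
      have "(\<Sum>i\<in>F. fps_const (f i) * fps_X ^ w i) $ m = (\<Sum>i\<in>F. if w i = m then f i else 0)"
        unfolding fps_sum_nth by (intro sum.cong) auto
      also have "\<dots> = (\<Sum>i | i \<in> F \<and> w i = m. f i)"
        using F by (simp add: sum.inter_filter)
      also have "{i. i \<in> F \<and> w i = m} = {i. i \<in> A \<and> w i = m}"
        using F that by (auto simp: B_def)
      finally show ?thesis by (simp add: weighted_series_def)
    qed
    then show "dist (\<Sum>i\<in>F. fps_const (f i) * fps_X ^ w i) (weighted_series w A f) < e"
      using N by (intro less_trans[OF nth_equal_imp_dist_less]) auto
  qed (use \<open>finite B\<close> in \<open>auto simp: B_def\<close>)
qed

lemma weighted_series_cong:
  "(\<And>i. i \<in> A \<Longrightarrow> f i = g i) \<Longrightarrow> weighted_series w A f = weighted_series w A g"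
  by (auto simp: weighted_series_def fps_eq_iff intro!: sum.cong)

lemma weighted_series_diff:
  "weighted_series w A (\<lambda>i. f i - g i) = weighted_series w A f - weighted_series w A g"
  by (simp add: weighted_series_def fps_eq_iff sum_subtractf)

lemma weighted_series_add:
  "weighted_series w A (\<lambda>i. f i + g i) = weighted_series w A f + weighted_series w A g"
  by (simp add: weighted_series_def fps_eq_iff sum.distrib)

lemma weighted_series_cmult:
  "weighted_series w A (\<lambda>i. c * f i) = fps_const c * weighted_series w A f"
  by (simp add: weighted_series_def fps_eq_iff sum_distrib_left)

lemma dilate_weighted_series:
  "dilate c (weighted_series w A f) = weighted_series w A (\<lambda>i. c ^ w i * f i)"
  by (simp add: weighted_series_def fps_eq_iff sum_distrib_left)

lemma weighted_series_Un:
  assumes "\<And>m. finite {i \<in> A \<union> B. w i = m}" "A \<inter> B = {}"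
  shows "weighted_series w (A \<union> B) f = weighted_series w A f + weighted_series w B f"
proof (rule fps_ext)
  fix m
  have eq: "{i \<in> A \<union> B. w i = m} = {i \<in> A. w i = m} \<union> {i \<in> B. w i = m}" by auto
  then have "finite ({i \<in> A. w i = m} \<union> {i \<in> B. w i = m})" using assms(1)[of m] by simp
  then have "sum f {i \<in> A \<union> B. w i = m} = sum f {i \<in> A. w i = m} + sum f {i \<in> B. w i = m}"
    unfolding eq using assms(2) by (intro sum.union_disjoint) auto
  then show "weighted_series w (A \<union> B) f $ m = (weighted_series w A f + weighted_series w B f) $ m"
    by (simp add: weighted_series_def)
qed

text \<open>This serves to lower one summation index when the terms in which it is \<open>0\<close> vanish, and to
  drop an index that is \<open>0\<close> throughout.\<close>

lemma weighted_series_reindex: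
  assumes fin: "\<And>m. finite {j \<in> B. v j = m}"
    and inj: "inj_on s A" and sub: "s ` A \<subseteq> B"
    and weight: "\<And>i. i \<in> A \<Longrightarrow> v (s i) = w i + l"
    and zero: "\<And>j. j \<in> B - s ` A \<Longrightarrow> g j = 0"
    and eq: "\<And>i. i \<in> A \<Longrightarrow> g (s i) = f i"
  shows "weighted_series v B g = fps_X ^ l * weighted_series w A f"
proof (rule fps_ext)
  fix m
  have "(\<Sum>j | j \<in> B \<and> v j = m. g j) = (\<Sum>j\<in>s ` {i \<in> A. w i + l = m}. g j)"
  proof (rule sum.mono_neutral_right)
    show "\<forall>j\<in>{j \<in> B. v j = m} - s ` {i \<in> A. w i + l = m}. g j = 0"
      using weight by (auto intro!: zero)
  qed (use fin sub weight in auto)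
  also have "\<dots> = (\<Sum>i | i \<in> A \<and> w i + l = m. f i)"
    using inj by (subst sum.reindex) (auto intro: inj_on_subset sum.cong simp: eq)
  also have "{i. i \<in> A \<and> w i + l = m} = (if m < l then {} else {i. i \<in> A \<and> w i = m - l})"
    by auto
  finally show "weighted_series v B g $ m = (fps_X ^ l * weighted_series w A f) $ m"
    by (simp add: weighted_series_def fps_X_power_mult_nth)
qed

section \<open>Contiguity relations for the triple series\<close>

lemma qpoch_0 [simp]: "qpoch a q 0 = 1"
  by (simp add: qpoch_def)

lemma qpoch_Suc: "qpoch a q (Suc n) = qpoch a q n * (1 - a * q ^ n)"
  by (simp add: qpoch_def)

lemma qpoch_Suc_left: "qpoch a q (Suc n) = (1 - a) * qpoch (a * q) q n"
  by (induction n) (simp_all add: qpoch_Suc mult_ac)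

definition num_parts :: "nat \<times> nat \<times> nat \<Rightarrow> nat" where
  "num_parts = (\<lambda>(n1, n2, n3). 3 * n3 + 2 * n2 + n1)"

lemma finite_num_parts: "finite {p \<in> A. num_parts p = m}"
proof (rule finite_subset)
  show "{p \<in> A. num_parts p = m} \<subseteq> {..m} \<times> {..m} \<times> {..m}"
    by (auto simp: num_parts_def)
qed simp

definition kr_exponent :: "nat \<Rightarrow> nat \<Rightarrow> nat \<Rightarrow> nat" where
  "kr_exponent n1 n2 n3 = (9 * n3\<^sup>2 + n3) div 2 + 2 * n2\<^sup>2 + n2 + n1\<^sup>2
     + 6 * n3 * n2 + 3 * n3 * n1 + 2 * n2 * n1"

lemma kr_exponent_Suc1: "kr_exponent (Suc n1) n2 n3 = kr_exponent n1 n2 n3 + 2 * n1 + 2 * n2 + 3 * n3 + 1"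
  by (simp add: kr_exponent_def power2_eq_square algebra_simps)

lemma kr_exponent_Suc2: "kr_exponent n1 (Suc n2) n3 = kr_exponent n1 n2 n3 + 2 * n1 + 4 * n2 + 6 * n3 + 3"
  by (simp add: kr_exponent_def power2_eq_square algebra_simps)

lemma kr_exponent_Suc3: "kr_exponent n1 n2 (Suc n3) = kr_exponent n1 n2 n3 + 3 * n1 + 6 * n2 + 9 * n3 + 5"
proof -
  have "9 * (Suc n3)\<^sup>2 + Suc n3 = 9 * n3\<^sup>2 + n3 + (9 * n3 + 5) * 2"
    by (simp add: power2_eq_square)
  then have "(9 * (Suc n3)\<^sup>2 + Suc n3) div 2 = (9 * n3\<^sup>2 + n3) div 2 + (9 * n3 + 5)"
    by simp
  then show ?thesis unfolding kr_exponent_def by (simp add: algebra_simps)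
qed

lemma num_parts_shift1:
  assumes "\<And>n2 n3. g (0, n2, n3) = 0" "\<And>n1 n2 n3. g (Suc n1, n2, n3) = f (n1, n2, n3)"
  shows "weighted_series num_parts UNIV g = fps_X ^ 1 * weighted_series num_parts UNIV f"
proof (rule weighted_series_reindex[where s = "\<lambda>(n1, n2, n3). (Suc n1, n2, n3)"])
  fix p :: "nat \<times> nat \<times> nat"
  assume "p \<in> UNIV - (\<lambda>(n1, n2, n3). (Suc n1, n2, n3)) ` UNIV"
  then show "g p = 0"
    using assms(1) by (cases p; cases "fst p") (auto simp: image_iff)
qed (rule finite_num_parts, auto simp: num_parts_def inj_on_def assms(2))

lemma num_parts_shift2:
  assumes "\<And>n1 n3. g (n1, 0, n3) = 0" "\<And>n1 n2 n3. g (n1, Suc n2, n3) = f (n1, n2, n3)"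
  shows "weighted_series num_parts UNIV g = fps_X ^ 2 * weighted_series num_parts UNIV f"
proof (rule weighted_series_reindex[where s = "\<lambda>(n1, n2, n3). (n1, Suc n2, n3)"])
  fix p :: "nat \<times> nat \<times> nat"
  assume "p \<in> UNIV - (\<lambda>(n1, n2, n3). (n1, Suc n2, n3)) ` UNIV"
  then show "g p = 0"
    using assms(1) by (cases p; cases "fst (snd p)") (auto simp: image_iff)
qed (rule finite_num_parts, auto simp: num_parts_def inj_on_def assms(2))

lemma num_parts_shift3:
  assumes "\<And>n1 n2. g (n1, n2, 0) = 0" "\<And>n1 n2 n3. g (n1, n2, Suc n3) = f (n1, n2, n3)"
  shows "weighted_series num_parts UNIV g = fps_X ^ 3 * weighted_series num_parts UNIV f"
proof (rule weighted_series_reindex[where s = "\<lambda>(n1, n2, n3). (n1, n2, Suc n3)"])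
  fix p :: "nat \<times> nat \<times> nat"
  assume "p \<in> UNIV - (\<lambda>(n1, n2, n3). (n1, n2, Suc n3)) ` UNIV"
  then show "g p = 0"
    using assms(1) by (cases p; cases "snd (snd p)") (auto simp: image_iff)
qed (rule finite_num_parts, auto simp: num_parts_def inj_on_def assms(2))

context
  fixes q :: "'a::field"
begin

definition q_denominator :: "nat \<times> nat \<times> nat \<Rightarrow> 'a" where
  "q_denominator = (\<lambda>(n1, n2, n3). qpoch q q n1 * qpoch (q\<^sup>2) (q\<^sup>2) n2 * qpoch (q ^ 3) (q ^ 3) n3)"

lemma q_denominator_Suc:
  "q_denominator (Suc n1, n2, n3) = q_denominator (n1, n2, n3) * (1 - q ^ Suc n1)"
  "q_denominator (n1, Suc n2, n3) = q_denominator (n1, n2, n3) * (1 - q ^ (2 * Suc n2))"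
  "q_denominator (n1, n2, Suc n3) = q_denominator (n1, n2, n3) * (1 - q ^ (3 * Suc n3))"
  by (simp_all add: q_denominator_def qpoch_Suc power_mult del: mult_Suc_right)

text \<open>The summand of \<open>F a b c\<close>. The parameters make visible that multiplying \<open>x\<close> by \<open>q\<^sup>k\<close> adds
  \<open>(k, 2 k, 3 k)\<close> to \<open>(a, b, c)\<close>.\<close>

definition F_summand :: "nat \<Rightarrow> nat \<Rightarrow> nat \<Rightarrow> nat \<times> nat \<times> nat \<Rightarrow> 'a" where
  "F_summand a b c = (\<lambda>(n1, n2, n3). q ^ (kr_exponent n1 n2 n3 + a * n1 + b * n2 + c * n3)
     * qpoch (- q) (q\<^sup>2) n2 / q_denominator (n1, n2, n3))"

lemma F_summand_add:
  "F_summand (a + i) (b + j) (c + k) (n1, n2, n3) =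
     q ^ (i * n1 + j * n2 + k * n3) * F_summand a b c (n1, n2, n3)"
proof -
  have "kr_exponent n1 n2 n3 + (a + i) * n1 + (b + j) * n2 + (c + k) * n3 =
      (i * n1 + j * n2 + k * n3) + (kr_exponent n1 n2 n3 + a * n1 + b * n2 + c * n3)"
    by (simp add: algebra_simps)
  then show ?thesis
    by (simp only: F_summand_def prod.case power_add[of q "i * n1 + j * n2 + k * n3"]) simp
qed

definition F :: "nat \<Rightarrow> nat \<Rightarrow> nat \<Rightarrow> 'a fps" where
  "F a b c = weighted_series num_parts UNIV (F_summand a b c)"

lemma dilate_F: "dilate (q ^ k) (F a b c) = F (a + k) (b + 2 * k) (c + 3 * k)"
  unfolding F_def dilate_weighted_series
proof (rule weighted_series_cong)
  fix p :: "nat \<times> nat \<times> nat"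
  obtain n1 n2 n3 where p: "p = (n1, n2, n3)" by (cases p)
  have "k * num_parts p = k * n1 + 2 * k * n2 + 3 * k * n3"
    by (simp add: p num_parts_def algebra_simps)
  then show "(q ^ k) ^ num_parts p * F_summand a b c p = F_summand (a + k) (b + 2 * k) (c + 3 * k) p"
    unfolding p F_summand_add by (simp flip: power_mult)
qed

definition kr_summand :: "nat \<times> nat \<times> nat \<Rightarrow> 'a" where
  "kr_summand = (\<lambda>(n1, n2, n3). q ^ kr_exponent n1 n2 n3 * qpoch (- 1 / q) (q\<^sup>2) n2 / q_denominator (n1, n2, n3))"

definition kr_series :: "'a fps" where
  "kr_series = weighted_series num_parts UNIV kr_summand"

lemma F_003_0: "F 0 0 3 $ 0 = 1"
proof -
  have "{p. num_parts p = 0} = {(0, 0, 0)}" by (auto simp: num_parts_def)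
  then show ?thesis
    by (simp add: F_def weighted_series_def F_summand_def q_denominator_def kr_exponent_def)
qed

context
  assumes q0: "q \<noteq> 0" and q1: "\<And>m. 0 < m \<Longrightarrow> q ^ m \<noteq> 1"
begin

lemma q_factor_nonzero: "0 < m \<Longrightarrow> 1 - q ^ m \<noteq> 0"
  using q1[of m] by auto

lemma qpoch_inverse_Suc: "qpoch (- 1 / q) (q\<^sup>2) (Suc n) = (1 + 1 / q) * qpoch (- q) (q\<^sup>2) n"
  using q0 by (simp add: qpoch_Suc_left power2_eq_square)

text \<open>The difference multiplies the summand by \<open>1 - q\<^bsup>n1\<^esup>\<close>. This kills the terms with \<open>n\<^sub>1 = 0\<close> and
  cancels the last factor of \<open>(q; q)\<close> in the others, so that \<open>n\<^sub>1\<close> can be lowered by one; the parameters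
  on the right record the linear part of the increment of the quadratic exponent. The same happens for
  \<open>n\<^sub>2\<close> and \<open>n\<^sub>3\<close> below; for \<open>n\<^sub>2\<close> the numerator \<open>(-q; q\<^sup>2)\<close> leaves a factor
  \<open>1 + q\<^bsup>2 n2 + 1\<^esup>\<close>, hence two terms.\<close>

lemma F_shift1: "F a b c - F (a + 1) b c = fps_const (q ^ (1 + a)) * fps_X * F (a + 2) (b + 2) (c + 3)"
proof -
  have "weighted_series num_parts UNIV (\<lambda>p. F_summand a b c p - F_summand (a + 1) b c p) =
      fps_X ^ 1 * weighted_series num_parts UNIV (\<lambda>p. q ^ (1 + a) * F_summand (a + 2) (b + 2) (c + 3) p)"
  proof (rule num_parts_shift1)
    fix n1 n2 n3 :: nat
    have diff: "F_summand a b c (m, n2, n3) - F_summand (a + 1) b c (m, n2, n3) =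
        (1 - q ^ m) * F_summand a b c (m, n2, n3)" for m
      using F_summand_add[of a 1 b 0 c 0 m n2 n3] by (simp add: algebra_simps)
    show "F_summand a b c (0, n2, n3) - F_summand (a + 1) b c (0, n2, n3) = 0"
      unfolding diff by simp
    have e: "kr_exponent (Suc n1) n2 n3 + a * Suc n1 + b * n2 + c * n3 =
        (1 + a) + (kr_exponent n1 n2 n3 + (a + 2) * n1 + (b + 2) * n2 + (c + 3) * n3)"
      by (simp add: kr_exponent_Suc1 algebra_simps)
    show "F_summand a b c (Suc n1, n2, n3) - F_summand (a + 1) b c (Suc n1, n2, n3) =
        q ^ (1 + a) * F_summand (a + 2) (b + 2) (c + 3) (n1, n2, n3)"
      unfolding diff unfolding F_summand_def prod.case e power_add[of q "1 + a"] q_denominator_Suc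
      using q_factor_nonzero[of "Suc n1"] by (simp del: power_Suc)
  qed
  then show ?thesis
    by (simp add: F_def weighted_series_diff weighted_series_cmult mult_ac)
qed

lemma F_shift2:
  "F a b c - F a (b + 2) c =
     fps_const (q ^ (3 + b)) * fps_X ^ 2 *
       (F (a + 2) (b + 4) (c + 6) + fps_const q * F (a + 2) (b + 6) (c + 6))"
proof -
  let ?f = "\<lambda>p. q ^ (3 + b) * (F_summand (a + 2) (b + 4) (c + 6) p + q * F_summand (a + 2) (b + 6) (c + 6) p)"
  have "weighted_series num_parts UNIV (\<lambda>p. F_summand a b c p - F_summand a (b + 2) c p) =
      fps_X ^ 2 * weighted_series num_parts UNIV ?f"
  proof (rule num_parts_shift2)
    fix n1 n2 n3 :: nat
    have diff: "F_summand a b c (n1, m, n3) - F_summand a (b + 2) c (n1, m, n3) =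
        (1 - q ^ (2 * m)) * F_summand a b c (n1, m, n3)" for m
      using F_summand_add[of a 0 b 2 c 0 n1 m n3] by (simp add: algebra_simps)
    show "F_summand a b c (n1, 0, n3) - F_summand a (b + 2) c (n1, 0, n3) = 0"
      unfolding diff by simp
    have e: "kr_exponent n1 (Suc n2) n3 + a * n1 + b * Suc n2 + c * n3 =
        (3 + b) + (kr_exponent n1 n2 n3 + (a + 2) * n1 + (b + 4) * n2 + (c + 6) * n3)"
      by (simp add: kr_exponent_Suc2 algebra_simps)
    have "F_summand a b c (n1, Suc n2, n3) - F_summand a (b + 2) c (n1, Suc n2, n3) =
        q ^ (3 + b) * ((1 + q * q ^ (2 * n2)) * F_summand (a + 2) (b + 4) (c + 6) (n1, n2, n3))"
      unfolding diff unfolding F_summand_def prod.case e power_add[of q "3 + b"] q_denominator_Suc qpoch_Suc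
      using q_factor_nonzero[of "2 * Suc n2"]
      by (simp add: mult_ac flip: power_mult del: power_Suc mult_Suc_right)
    also have "\<dots> = ?f (n1, n2, n3)"
      using F_summand_add[of "a + 2" 0 "b + 4" 2 "c + 6" 0 n1 n2 n3] by (simp add: algebra_simps)
    finally show "F_summand a b c (n1, Suc n2, n3) - F_summand a (b + 2) c (n1, Suc n2, n3) =
        ?f (n1, n2, n3)" .
  qed
  then show ?thesis
    by (simp add: F_def weighted_series_diff weighted_series_cmult weighted_series_add mult_ac)
qed

lemma F_shift3:
  "F a b c - F a b (c + 3) = fps_const (q ^ (5 + c)) * fps_X ^ 3 * F (a + 3) (b + 6) (c + 9)"
proof -
  have "weighted_series num_parts UNIV (\<lambda>p. F_summand a b c p - F_summand a b (c + 3) p) =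
      fps_X ^ 3 * weighted_series num_parts UNIV (\<lambda>p. q ^ (5 + c) * F_summand (a + 3) (b + 6) (c + 9) p)"
  proof (rule num_parts_shift3)
    fix n1 n2 n3 :: nat
    have diff: "F_summand a b c (n1, n2, m) - F_summand a b (c + 3) (n1, n2, m) =
        (1 - q ^ (3 * m)) * F_summand a b c (n1, n2, m)" for m
      using F_summand_add[of a 0 b 0 c 3 n1 n2 m] by (simp add: algebra_simps)
    show "F_summand a b c (n1, n2, 0) - F_summand a b (c + 3) (n1, n2, 0) = 0"
      unfolding diff by simp
    have e: "kr_exponent n1 n2 (Suc n3) + a * n1 + b * n2 + c * Suc n3 =
        (5 + c) + (kr_exponent n1 n2 n3 + (a + 3) * n1 + (b + 6) * n2 + (c + 9) * n3)"
      by (simp add: kr_exponent_Suc3 algebra_simps)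
    show "F_summand a b c (n1, n2, Suc n3) - F_summand a b (c + 3) (n1, n2, Suc n3) =
        q ^ (5 + c) * F_summand (a + 3) (b + 6) (c + 9) (n1, n2, n3)"
      unfolding diff unfolding F_summand_def prod.case e power_add[of q "5 + c"] q_denominator_Suc
      using q_factor_nonzero[of "3 * Suc n3"] by (simp del: power_Suc mult_Suc_right)
  qed
  then show ?thesis
    by (simp add: F_def weighted_series_diff weighted_series_cmult mult_ac)
qed

text \<open>Both series have the same terms with \<open>n\<^sub>2 = 0\<close>. For the others, the difference of the numerators
  \<open>(-1/q; q\<^sup>2)\<close> and \<open>(-q; q\<^sup>2)\<close> contains the last factor of \<open>(q\<^sup>2; q\<^sup>2)\<close>, and again the index is
  lowered by one.\<close>

lemma kr_series_eq: "kr_series = F 0 0 0 + fps_const (q ^ 2) * fps_X ^ 2 * F 2 4 6"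
proof -
  have "weighted_series num_parts UNIV (\<lambda>p. kr_summand p - F_summand 0 0 0 p) =
      fps_X ^ 2 * weighted_series num_parts UNIV (\<lambda>p. q ^ 2 * F_summand 2 4 6 p)"
  proof (rule num_parts_shift2)
    fix n1 n2 n3 :: nat
    show "kr_summand (n1, 0, n3) - F_summand 0 0 0 (n1, 0, n3) = 0"
      by (simp add: F_summand_def kr_summand_def)
    have e: "kr_exponent n1 (Suc n2) n3 = 3 + (kr_exponent n1 n2 n3 + 2 * n1 + 4 * n2 + 6 * n3)"
        (is "?e = _ + ?e'")
      by (simp add: kr_exponent_Suc2)
    have qq: "q ^ ?e * (1 / q) = q ^ 2 * q ^ ?e'"
      unfolding e power_add[of q 3] using q0 by (simp add: eval_nat_numeral)
    have "(1 + 1 / q) * qpoch (- q) (q\<^sup>2) n2 - qpoch (- q) (q\<^sup>2) (Suc n2) =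
        1 / q * (1 - q ^ (2 * Suc n2)) * qpoch (- q) (q\<^sup>2) n2"
      using q0 by (simp add: qpoch_Suc power_mult field_simps power2_eq_square)
    then have "kr_summand (n1, Suc n2, n3) - F_summand 0 0 0 (n1, Suc n2, n3) =
        q ^ ?e * (1 / q * (1 - q ^ (2 * Suc n2)) * qpoch (- q) (q\<^sup>2) n2) / q_denominator (n1, Suc n2, n3)"
      unfolding F_summand_def kr_summand_def prod.case qpoch_inverse_Suc
      by (simp only: mult_0 add_0_right diff_divide_distrib[symmetric] right_diff_distrib[symmetric])
    also have "\<dots> = (q ^ ?e * (1 / q)) * qpoch (- q) (q\<^sup>2) n2 / q_denominator (n1, n2, n3)"
      using q_factor_nonzero[of "2 * Suc n2"] by (simp add: q_denominator_Suc del: power_Suc mult_Suc_right)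
    also have "\<dots> = q ^ 2 * F_summand 2 4 6 (n1, n2, n3)"
      unfolding qq by (simp add: F_summand_def)
    finally show "kr_summand (n1, Suc n2, n3) - F_summand 0 0 0 (n1, Suc n2, n3) =
        q ^ 2 * F_summand 2 4 6 (n1, n2, n3)" .
  qed
  then show ?thesis
    by (simp add: F_def kr_series_def weighted_series_diff weighted_series_cmult algebra_simps)
qed

lemma F_000: "F 0 0 0 = F 0 0 3 + fps_const (q ^ 5) * fps_X ^ 3 * dilate (q ^ 3) (F 0 0 0)"
proof -
  have "dilate (q ^ 3) (F 0 0 0) = F 3 6 9"
    by (subst dilate_F) simp
  then show ?thesis
    using F_shift3[of 0 0 0] by (simp only: diff_eq_eq add.commute) simp
qed

lemma kr_series_dilate:
  "kr_series = F 0 0 0 + fps_const (q ^ 2) * fps_X ^ 2 * dilate (q ^ 2) (F 0 0 0)"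
proof -
  have "dilate (q ^ 2) (F 0 0 0) = F 2 4 6"
    by (subst dilate_F) (simp del: add_2_eq_Suc')
  then show ?thesis by (simp add: kr_series_eq)
qed

text \<open>Raising \<open>a\<close> from \<open>0\<close> to \<open>1\<close> and then \<open>b\<close> from \<open>0\<close> to \<open>2\<close> leads from \<open>F 0 0 3\<close> to
  \<open>F 1 2 3 = F 0 0 0 (x q)\<close>, the main part of \<open>A(x q)\<close>. The remaining terms match after one further relation
  that compares \<open>F 1 2 6\<close> with \<open>F 2 2 6\<close>.\<close>

lemma F_003: "F 0 0 3 = dilate q kr_series + fps_const q * fps_X * dilate q (F 0 0 3)"
proof -
  note add_2_eq_Suc' [simp del]
  have "dilate q (F 0 0 0) = F 1 2 3" "dilate q (F 2 4 6) = F 3 6 9"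
    using dilate_F[of 1 0 0 0] dilate_F[of 1 2 4 6] by simp_all
  then have "dilate q kr_series = F 1 2 3 + fps_const q ^ 4 * fps_X ^ 2 * F 3 6 9"
    by (simp add: kr_series_eq dilate_add dilate_monomial_mult fps_const_power flip: power_add)
  moreover have "dilate q (F 0 0 3) = F 1 2 6"
    using dilate_F[of 1 0 0 3] by simp
  moreover have "F 0 0 3 = F 1 0 3 + fps_const q * fps_X * F 2 2 6"
    using F_shift1[of 0 0 3] by (simp add: algebra_simps)
  moreover have "F 1 2 6 = F 2 2 6 + fps_const q ^ 2 * fps_X * F 3 4 9"
    using F_shift1[of 1 2 6] by (simp add: algebra_simps power2_eq_square flip: numeral_2_eq_2)
  moreover have "F 1 0 3 = F 1 2 3 + fps_const q ^ 3 * fps_X ^ 2 * (F 3 4 9 + fps_const q * F 3 6 9)"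
    using F_shift2[of 1 0 3] by (simp add: algebra_simps)
  ultimately show ?thesis by algebra
qed

end

end

section \<open>The generating function identity\<close>

lemma fls_X_power_neq_1: "0 < m \<Longrightarrow> (fls_X :: 'a::field fls) ^ m \<noteq> 1"
proof
  assume "0 < m" "(fls_X :: 'a fls) ^ m = 1"
  then have "fls_nth ((fls_X :: 'a fls) ^ m) 0 = fls_nth 1 0" by simp
  with \<open>0 < m\<close> show False by simp
qed

lemma gen_fun_eq_kr_series: "gen_fun kr_c_2_2 = kr_series fls_X"
proof -
  have q: "(fls_X :: rat fls) \<noteq> 0" "\<And>m. 0 < m \<Longrightarrow> (fls_X :: rat fls) ^ m \<noteq> 1"
    by (simp_all add: fls_X_power_neq_1)
  show ?thesis
    unfolding gf_kr
    by (rule dilate_system_unique[OF q(2) gf_all gf_no_pair gf_no_triple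
          kr_series_dilate[OF q] F_000[OF q] F_003[OF q]])
      (simp_all add: gf_no_triple_0 F_003_0)
qed

theorem theorem17:
  shows "let
      q = (fls_X :: rat fls);
      x = (fps_X :: rat fls fps);
      S1 = (\<lambda>(n1, n2, n3). fps_const (
          q powi (int ((9 * n3\<^sup>2 + n3) div 2 + 2 * n2\<^sup>2 + n2 + n1\<^sup>2
                       + 6 * n3 * n2 + 3 * n3 * n1 + 2 * n2 * n1) - 1)
          * (1 + q) * qpoch (- q) (q\<^sup>2) (n2 - 1)
          / (qpoch q q n1 * qpoch (q\<^sup>2) (q\<^sup>2) n2 * qpoch (q ^ 3) (q ^ 3) n3))
        * x ^ (3 * n3 + 2 * n2 + n1));
      S2 = (\<lambda>(n1, n3). fps_const (
          q ^ ((9 * n3\<^sup>2 + n3) div 2 + n1\<^sup>2 + 3 * n3 * n1)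
          / (qpoch q q n1 * qpoch (q ^ 3) (q ^ 3) n3))
        * x ^ (3 * n3 + n1));
      S3 = (\<lambda>(n1, n2, n3). fps_const (
          q ^ ((9 * n3\<^sup>2 + n3) div 2 + 2 * n2\<^sup>2 + n2 + n1\<^sup>2
               + 6 * n3 * n2 + 3 * n3 * n1 + 2 * n2 * n1)
          * qpoch (- 1 / q) (q\<^sup>2) n2
          / (qpoch q q n1 * qpoch (q\<^sup>2) (q\<^sup>2) n2 * qpoch (q ^ 3) (q ^ 3) n3))
        * x ^ (3 * n3 + 2 * n2 + n1));
      I = {(n1, n2, n3). 0 < n2} :: (nat \<times> nat \<times> nat) set
    in S1 summable_on I \<and> S2 summable_on UNIV \<and> S3 summable_on UNIV \<and>
       gen_fun kr_c_2_2 = infsum S1 I + infsum S2 UNIV \<and>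
       infsum S1 I + infsum S2 UNIV = infsum S3 UNIV"
proof -
  define q where "q = (fls_X :: rat fls)"
  have q: "q \<noteq> 0" "\<And>m. 0 < m \<Longrightarrow> q ^ m \<noteq> 1"
    by (simp_all add: q_def fls_X_power_neq_1)
  define I where "I = ({(n1, n2, n3). 0 < n2} :: (nat \<times> nat \<times> nat) set)"
  define x where "x = (fps_X :: rat fls fps)"
  define S where "S = (\<lambda>p. fps_const (kr_summand q p) * x ^ num_parts p)"
  define S1 where "S1 = (\<lambda>(n1, n2, n3). fps_const (
          q powi (int ((9 * n3\<^sup>2 + n3) div 2 + 2 * n2\<^sup>2 + n2 + n1\<^sup>2
                       + 6 * n3 * n2 + 3 * n3 * n1 + 2 * n2 * n1) - 1)
          * (1 + q) * qpoch (- q) (q\<^sup>2) (n2 - 1)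
          / (qpoch q q n1 * qpoch (q\<^sup>2) (q\<^sup>2) n2 * qpoch (q ^ 3) (q ^ 3) n3))
        * x ^ (3 * n3 + 2 * n2 + n1))"
  define S2 where "S2 = (\<lambda>(n1, n3). fps_const (
          q ^ ((9 * n3\<^sup>2 + n3) div 2 + n1\<^sup>2 + 3 * n3 * n1)
          / (qpoch q q n1 * qpoch (q ^ 3) (q ^ 3) n3))
        * x ^ (3 * n3 + n1))"
  define S3 where "S3 = (\<lambda>(n1, n2, n3). fps_const (
          q ^ ((9 * n3\<^sup>2 + n3) div 2 + 2 * n2\<^sup>2 + n2 + n1\<^sup>2
               + 6 * n3 * n2 + 3 * n3 * n1 + 2 * n2 * n1)
          * qpoch (- 1 / q) (q\<^sup>2) n2
          / (qpoch q q n1 * qpoch (q\<^sup>2) (q\<^sup>2) n2 * qpoch (q ^ 3) (q ^ 3) n3))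
        * x ^ (3 * n3 + 2 * n2 + n1))"
  have S3: "S3 = S"
    unfolding S3_def S_def
    by (simp add: fun_eq_iff kr_summand_def q_denominator_def kr_exponent_def num_parts_def)
  \<comment> \<open>The first factor of \<open>(-1/q; q\<^sup>2)\<close> is \<open>1 + 1/q\<close>; clearing its denominator lowers the exponent by one.\<close>
  have S1: "S1 p = S p" if "p \<in> I" for p
  proof -
    obtain n1 n3 m where p: "p = (n1, Suc m, n3)"
      using \<open>p \<in> I\<close> by (cases p; cases "fst (snd p)") (auto simp: I_def)
    have "q ^ kr_exponent n1 (Suc m) n3 * (1 + 1 / q) =
        q powi (int (kr_exponent n1 (Suc m) n3) - 1) * (1 + q)"
      using q(1) by (simp add: power_int_diff field_simps)
    then have "kr_summand q p =
        q powi (int (kr_exponent n1 (Suc m) n3) - 1) * (1 + q) * qpoch (- q) (q\<^sup>2) m / q_denominator q p"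
      by (simp only: p kr_summand_def prod.case qpoch_inverse_Suc[OF q] mult.assoc[symmetric])
    then show ?thesis
      unfolding S_def S1_def
      by (simp only: p prod.case num_parts_def q_denominator_def kr_exponent_def diff_Suc_1)
  qed
  have "(S has_sum weighted_series num_parts A (kr_summand q)) A" for A
    unfolding S_def x_def by (rule has_sum_weighted_series) (rule finite_num_parts)
  then have sum1: "(S1 has_sum weighted_series num_parts I (kr_summand q)) I"
    and sum3: "(S3 has_sum kr_series q) UNIV"
    using has_sum_cong[of I S1 S] S1 by (simp_all add: S3 kr_series_def)
  \<comment> \<open>The double sum consists of the terms with \<open>n\<^sub>2 = 0\<close>.\<close>
  define w where "w = (\<lambda>(n1, n3). 3 * n3 + n1 :: nat)"
  define t where "t = (\<lambda>(n1, n3). kr_summand q (n1, 0, n3))"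
  have "S2 = (\<lambda>p. fps_const (t p) * fps_X ^ w p)"
    by (simp add: fun_eq_iff S2_def t_def w_def x_def kr_summand_def q_denominator_def kr_exponent_def)
  moreover have "finite {p \<in> UNIV. w p = m}" for m
    by (rule finite_subset[of _ "{..m} \<times> {..m}"]) (auto simp: w_def)
  ultimately have "(S2 has_sum weighted_series w UNIV t) UNIV"
    using has_sum_weighted_series[of UNIV w t] by simp
  also have "weighted_series w UNIV t = weighted_series num_parts (- I) (kr_summand q)"
  proof -
    have "weighted_series num_parts (- I) (kr_summand q) = fps_X ^ 0 * weighted_series w UNIV t"
      by (rule weighted_series_reindex[where s = "\<lambda>(n1, n3). (n1, 0, n3)"], rule finite_num_parts)
        (auto simp: inj_on_def I_def num_parts_def w_def t_def image_iff)
    then show ?thesis by simp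
  qed
  finally have sum2: "(S2 has_sum weighted_series num_parts (- I) (kr_summand q)) UNIV" .
  have "weighted_series num_parts I (kr_summand q) + weighted_series num_parts (- I) (kr_summand q) =
      kr_series q"
    using weighted_series_Un[of I "- I" num_parts "kr_summand q", OF finite_num_parts]
    by (simp add: kr_series_def)
  then have "S1 summable_on I \<and> S2 summable_on UNIV \<and> S3 summable_on UNIV \<and>
       gen_fun kr_c_2_2 = infsum S1 I + infsum S2 UNIV \<and>
       infsum S1 I + infsum S2 UNIV = infsum S3 UNIV"
    using sum1 sum2 sum3 by (auto simp: infsumI gen_fun_eq_kr_series q_def intro: has_sum_imp_summable)
  then show ?thesis
    unfolding Let_def S1_def S2_def S3_def I_def q_def x_def .
qed

end
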